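(* Consider the 26 hybrid vincular patterns of length 3 (defined in the context). Then: (i) $\underline{01}0$ and $\underline{01}1$ are Wilf equivalent, but not strongly Wilf equivalent; (ii) $\underline{10}0$ and $\underline{10}1$ are Wilf equivalent, but not strongly Wilf equivalent; (iii) $1\underline{01}$ and $1\underline{10}$ are strongly Wilf equivalent, but not super-strongly Wilf equivalent; (iv) $2\underline{01}$ and $2\underline{10}$ are Wilf equivalent, but not strongly Wilf equivalent. Moreover, these are the only generalized Wilf equivalences among hybrid vincular patterns of length 3: if $p\neq p'$ are hybrid vincular patterns of length 3 that are Wilf equivalent, then $\{p,p'\}$ is one of the four pairs listed in (i)–(iv).
   Context: An inversion sequence of length $n$ is a sequence $e=e_1e_2\dots e_n$ of integers with $0\le e_i<i$ for all $i$; $\mathbf{I}_n$ denotes the set of these. The reduction of an integer word $w$ is obtained by replacing every occurrence of the $i$th smallest value of $w$ by $i-1$, for all $i$. A hybrid vincular pattern of length 3 is a word $p=p_1p_2p_3$ with $p_i\in\{0,1,2\}$ such that any value $j>0$ appears only if $j-1$ appears, in which exactly one of the two adjacent pairs $p_1p_2$ or $p_2p_3$ is underlined (written $\underline{p_1p_2}p_3$ or $p_1\underline{p_2p_3}$). An occurrence of $p$ in $e\in\mathbf{I}_n$ is a set of positions $\{i_1<i_2<i_3\}$ such that the reduction of $e_{i_1}e_{i_2}e_{i_3}$ equals $p_1p_2p_3$, and additionally $i_2=i_1+1$ if $p_1p_2$ is underlined, resp. $i_3=i_2+1$ if $p_2p_3$ is underlined. Let $\mathrm{oc}(p,e)$ be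 the number of occurrences, $\mathbf{I}_n(p,m)=\{e\in\mathbf{I}_n:\mathrm{oc}(p,e)=m\}$ and $\mathbf{I}_n(p)=\mathbf{I}_n(p,0)$. For $S$ a set of 3-element subsets of $[n]$, let $\mathbf{I}_n(p,S)$ be the set of $e\in\mathbf{I}_n$ whose set of occurrences of $p$ (as position sets) is exactly $S$. Patterns $p,p'$ are Wilf equivalent if $|\mathbf{I}_n(p)|=|\mathbf{I}_n(p')|$ for all $n$; strongly Wilf equivalent if $|\mathbf{I}_n(p,m)|=|\mathbf{I}_n(p',m)|$ for all $n,m$; super-strongly Wilf equivalent if $|\mathbf{I}_n(p,S)|=|\mathbf{I}_n(p',S)|$ for all $n$ and all sets $S$ of 3-element subsets of $[n]$. A generalized Wilf equivalence means an equivalence of any of these three types. *)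

theory Defs
  imports Main
begin

(* Words are lists of naturals and positions are counted from 0, following the list library: the
   entry e_i of the usual 1-based notation is e ! (i - 1), and [n] becomes {..<n}.  The condition
   e_i < i thus reads e ! i \<le> i. *)

definition inv_seqs :: "nat \<Rightarrow> nat list set" where
  "inv_seqs n = {e. length e = n \<and> (\<forall>i<n. e ! i \<le> i)}"

(* The i-th smallest value of w is the one with exactly i - 1 distinct values of w below it. *)

definition reduction :: "nat list \<Rightarrow> nat list" where
  "reduction w = map (\<lambda>x. card {y \<in> set w. y < x}) w"

(* The constructor records which adjacent pair of letters is underlined: p1 p2 or p2 p3. *)

datatype vincular = Underline12 (letters: "nat list") | Underline23 (letters: "nat list")

definition hybrid_patterns :: "vincular set" where
  "hybrid_patterns = {p. length (letters p) = 3 \<and> set (letters p) \<subseteq> {0, 1, 2} \<and>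
     (\<forall>j \<in> set (letters p). j > 0 \<longrightarrow> j - 1 \<in> set (letters p))}"

fun adjacency :: "vincular \<Rightarrow> nat \<Rightarrow> nat \<Rightarrow> nat \<Rightarrow> bool" where
  "adjacency (Underline12 w) i1 i2 i3 \<longleftrightarrow> i2 = i1 + 1"
| "adjacency (Underline23 w) i1 i2 i3 \<longleftrightarrow> i3 = i2 + 1"

definition occurrences :: "vincular \<Rightarrow> nat list \<Rightarrow> nat set set" where
  "occurrences p e = {{i1, i2, i3} | i1 i2 i3.
     i1 < i2 \<and> i2 < i3 \<and> i3 < length e \<and>
     reduction [e ! i1, e ! i2, e ! i3] = letters p \<and> adjacency p i1 i2 i3}"

definition oc :: "vincular \<Rightarrow> nat list \<Rightarrow> nat" where
  "oc p e = card (occurrences p e)"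

definition inv_seqs_oc :: "nat \<Rightarrow> vincular \<Rightarrow> nat \<Rightarrow> nat list set" where
  "inv_seqs_oc n p m = {e \<in> inv_seqs n. oc p e = m}"

definition inv_seqs_avoid :: "nat \<Rightarrow> vincular \<Rightarrow> nat list set" where
  "inv_seqs_avoid n p = inv_seqs_oc n p 0"

definition inv_seqs_at :: "nat \<Rightarrow> vincular \<Rightarrow> nat set set \<Rightarrow> nat list set" where
  "inv_seqs_at n p S = {e \<in> inv_seqs n. occurrences p e = S}"

definition wilf_equiv :: "vincular \<Rightarrow> vincular \<Rightarrow> bool" where
  "wilf_equiv p q \<longleftrightarrow> (\<forall>n. card (inv_seqs_avoid n p) = card (inv_seqs_avoid n q))"

definition strongly_wilf_equiv :: "vincular \<Rightarrow> vincular \<Rightarrow> bool" where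
  "strongly_wilf_equiv p q \<longleftrightarrow> (\<forall>n m. card (inv_seqs_oc n p m) = card (inv_seqs_oc n q m))"

definition super_strongly_wilf_equiv :: "vincular \<Rightarrow> vincular \<Rightarrow> bool" where
  "super_strongly_wilf_equiv p q \<longleftrightarrow>
     (\<forall>n. \<forall>S \<subseteq> {A. A \<subseteq> {..<n} \<and> card A = 3}.
        card (inv_seqs_at n p S) = card (inv_seqs_at n q S))"

definition generalized_wilf_equiv :: "vincular \<Rightarrow> vincular \<Rightarrow> bool" where
  "generalized_wilf_equiv p q \<longleftrightarrow>
     wilf_equiv p q \<or> strongly_wilf_equiv p q \<or> super_strongly_wilf_equiv p q"

lemma card_hybrid_patterns: "card hybrid_patterns = 26"
proof -
  define L :: "nat list list" where "L = [[0,0,0],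
    [0,0,1],[0,1,0],[1,0,0],[0,1,1],[1,0,1],[1,1,0],
    [0,1,2],[0,2,1],[1,0,2],[1,2,0],[2,0,1],[2,1,0]]"
  have L: "length w = 3 \<and> set w \<subseteq> {0, 1, 2} \<and> (\<forall>j \<in> set w. j > 0 \<longrightarrow> j - 1 \<in> set w)
      \<longleftrightarrow> w \<in> set L" for w
  proof -
    have "length w = 3 \<Longrightarrow> \<exists>a b c. w = [a, b, c]"
      by (force simp: length_Suc_conv numeral_3_eq_3)
    moreover have "?thesis" if w: "w = [a, b, c]" for a b c
    proof (cases "a \<in> {0, 1, 2} \<and> b \<in> {0, 1, 2} \<and> c \<in> {0, 1, 2}")
      case True
      then have "a = 0 \<or> a = 1 \<or> a = 2" "b = 0 \<or> b = 1 \<or> b = 2" "c = 0 \<or> c = 1 \<or> c = 2"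
        by simp_all
      then show ?thesis
        unfolding w L_def by (elim disjE) simp_all
    next
      case False
      then show ?thesis
        unfolding w L_def by auto
    qed
    moreover have "length w = 3" if "w \<in> set L"
      using that unfolding L_def by auto
    ultimately show ?thesis by blast
  qed
  have "hybrid_patterns = Underline12 ` set L \<union> Underline23 ` set L" (is "_ = ?A \<union> ?B")
  proof (rule set_eqI)
    fix p show "p \<in> hybrid_patterns \<longleftrightarrow> p \<in> ?A \<union> ?B"
      unfolding hybrid_patterns_def mem_Collect_eq L by (cases p) auto
  qed
  moreover have "?A \<inter> ?B = {}" by auto
  moreover have "card ?A = card (set L)" "card ?B = card (set L)"
    by (auto intro!: card_image inj_onI)
  moreover have "card (set L) = 13"
    by (subst distinct_card) (simp_all add: L_def)
  ultimately show ?thesis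
    using card_Un_disjoint[of ?A ?B] by simp
qed

end

(* Wilf equivalences (i), (ii), (iv): build inversion sequences from left to right.  For a pattern
   with adjacent letters p1 p2 in (i) and (ii), every ascent (resp. descent) removes one letter from
   the letters available later on, and the number of continuations only depends on the number of
   available letters and on the rank of the last letter among them; both patterns give the same
   generating tree.  For (iv) the state is the maximum and the last letter.

   For 1-01 and 1-10, the occurrences are counted separately for each value a of the two equal
   letters.  Cut the word at the letters >= a.  The i-th letter a within a stretch of letters <= a
   contributes to 1-01 if the gap before it is nonempty and to 1-10 if the gap after it is nonempty,
   so rotating the emptiness pattern of the gaps turns one contribution into the other; keeping the
   contents of the nonempty gaps in order leaves the contributions of all other values unchanged.

   The remaining patterns are told apart by the numbers of avoiders of length 6, and of length 7
   for the pair 20-1, 21-0 (underlined: first two letters). *)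
theory Submission
  imports Defs
begin

subsection \<open>Counting extensions of a prefix\<close>

lemma reduction3:
  "reduction [a, b, c] =
     [of_bool (b < a) + of_bool (c < a \<and> c \<noteq> b),
      of_bool (a < b) + of_bool (c < b \<and> c \<noteq> a),
      of_bool (a < c) + of_bool (b < c \<and> b \<noteq> a)]"
proof -
  \<comment> \<open>The condition \<open>v \<noteq> u\<close> keeps a repeated smaller value from
    being counted twice.\<close>
  have card2: "card {y \<in> {u, v, x}. y < x} = of_bool (u < x) + of_bool (v < x \<and> v \<noteq> u)"
    for u v x :: nat
  proof -
    have "{y \<in> {u, v, x}. y < x} = (if u < x then {u} else {}) \<union> (if v < x then {v} else {})"
      by auto
    then show ?thesis by (auto simp: card_insert_if)
  qed
  have "{a, b, c} = {b, c, a}" "{a, b, c} = {a, c, b}" by auto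
  then show ?thesis
    unfolding reduction_def list.simps list.set
    using card2[of b c a] card2[of a c b] card2[of a b c] by simp
qed

lemma reduction_eq_iff:
  "reduction [a, b, c] = [0, 0, 0] \<longleftrightarrow> a = b \<and> b = c"
  "reduction [a, b, c] = [0, 0, 1] \<longleftrightarrow> a = b \<and> b < c"
  "reduction [a, b, c] = [0, 1, 0] \<longleftrightarrow> a = c \<and> a < b"
  "reduction [a, b, c] = [1, 0, 0] \<longleftrightarrow> b = c \<and> b < a"
  "reduction [a, b, c] = [0, 1, 1] \<longleftrightarrow> b = c \<and> a < b"
  "reduction [a, b, c] = [1, 0, 1] \<longleftrightarrow> a = c \<and> b < a"
  "reduction [a, b, c] = [1, 1, 0] \<longleftrightarrow> a = b \<and> c < b"
  "reduction [a, b, c] = [0, 1, 2] \<longleftrightarrow> a < b \<and> b < c"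
  "reduction [a, b, c] = [0, 2, 1] \<longleftrightarrow> a < c \<and> c < b"
  "reduction [a, b, c] = [1, 0, 2] \<longleftrightarrow> b < a \<and> a < c"
  "reduction [a, b, c] = [1, 2, 0] \<longleftrightarrow> c < a \<and> a < b"
  "reduction [a, b, c] = [2, 0, 1] \<longleftrightarrow> b < c \<and> c < a"
  "reduction [a, b, c] = [2, 1, 0] \<longleftrightarrow> c < b \<and> b < a"
  by (cases a b rule: linorder_cases; cases b c rule: linorder_cases;
      cases a c rule: linorder_cases; simp add: reduction3)+

lemmas reduction_eq_simps = reduction_eq_iff[unfolded One_nat_def]

text \<open>Prefixes are stored in reverse, so that the letters \<open>c\<close> is compared with come off the head.\<close>

fun new_occ :: "vincular \<Rightarrow> nat list \<Rightarrow> nat \<Rightarrow> nat" where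
  "new_occ (Underline12 w) (b # a # r) c =
     of_bool (reduction [a, b, c] = w) + new_occ (Underline12 w) (a # r) c"
| "new_occ (Underline12 w) r c = 0"
| "new_occ (Underline23 w) (b # r) c = length (filter (\<lambda>a. reduction [a, b, c] = w) r)"
| "new_occ (Underline23 w) [] c = 0"

text \<open>\<open>m\<close> is the number of occurrences still to be created; those inside the
  prefix are disregarded. The next letter has 0-based position \<open>length r\<close>, whence its
  bound.\<close>

fun count_ext :: "vincular \<Rightarrow> nat \<Rightarrow> nat list \<Rightarrow> nat \<Rightarrow> nat" where
  "count_ext p 0 r m = of_bool (m = 0)"
| "count_ext p (Suc k) r m =
     (\<Sum>v\<le>length r. if new_occ p r v \<le> m then count_ext p k (v # r) (m - new_occ p r v) else 0)"

lemma oc_Nil: "oc p [] = 0"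
  by (simp add: oc_def occurrences_def)

lemma finite_occurrences: "finite (occurrences p e)"
  by (rule finite_subset[of _ "Pow {..<length e}"]) (auto simp: occurrences_def)

lemma new_occ12:
  "new_occ (Underline12 w) (rev e) c =
     card {i. Suc i < length e \<and> reduction [e ! i, e ! Suc i, c] = w}"
proof (induction e rule: rev_induct)
  case Nil
  then show ?case by simp
next
  case (snoc b e)
  show ?case
  proof (cases e rule: rev_cases)
    case Nil
    then show ?thesis by simp
  next
    case (snoc e' a)
    let ?I = "{i. Suc i < length e \<and> reduction [e ! i, e ! Suc i, c] = w}"
    have "{i. Suc i < length (e @ [b]) \<and>
        reduction [(e @ [b]) ! i, (e @ [b]) ! Suc i, c] = w} =
        (if reduction [a, b, c] = w then insert (length e') ?I else ?I)"
      using snoc by (auto simp: nth_append less_Suc_eq split: if_splits)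
    moreover have "finite ?I" "length e' \<notin> ?I"
      using snoc by (auto intro: finite_subset[of _ "{..<length e}"])
    ultimately show ?thesis
      using snoc.IH snoc by simp
  qed
qed

lemma occurrences_snoc:
  "occurrences p (e @ [c]) = occurrences p e \<union>
     {{i1, i2, length e} | i1 i2. i1 < i2 \<and> i2 < length e \<and>
        reduction [e ! i1, e ! i2, c] = letters p \<and> adjacency p i1 i2 (length e)}"
  (is "_ = _ \<union> ?N")
proof (intro equalityI subsetI)
  fix A assume "A \<in> occurrences p (e @ [c])"
  then obtain i1 i2 i3 where *: "A = {i1, i2, i3}" "i1 < i2" "i2 < i3" "i3 < Suc (length e)"
    "reduction [(e @ [c]) ! i1, (e @ [c]) ! i2, (e @ [c]) ! i3] = letters p" "adjacency p i1 i2 i3"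
    by (auto simp: occurrences_def)
  show "A \<in> occurrences p e \<union> ?N"
  proof (cases "i3 = length e")
    case True
    with * show ?thesis by (auto simp: nth_append)
  next
    case False
    with * have "A \<in> occurrences p e"
      unfolding occurrences_def by (auto simp: nth_append)
    then show ?thesis ..
  qed
next
  fix A assume "A \<in> occurrences p e \<union> ?N"
  then show "A \<in> occurrences p (e @ [c])"
  proof
    assume "A \<in> occurrences p e"
    then obtain i1 i2 i3 where "A = {i1, i2, i3}" "i1 < i2" "i2 < i3" "i3 < length e"
      "reduction [e ! i1, e ! i2, e ! i3] = letters p" "adjacency p i1 i2 i3"
      by (auto simp: occurrences_def)
    then show ?thesis
      unfolding occurrences_def mem_Collect_eq
      by (intro exI[of _ i1] exI[of _ i2] exI[of _ i3]) (simp add: nth_append)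
  next
    assume "A \<in> ?N"
    then obtain i1 i2 where "A = {i1, i2, length e}" "i1 < i2" "i2 < length e"
      "reduction [e ! i1, e ! i2, c] = letters p" "adjacency p i1 i2 (length e)"
      by auto
    then show ?thesis
      unfolding occurrences_def mem_Collect_eq
      by (intro exI[of _ i1] exI[of _ i2] exI[of _ "length e"]) (simp add: nth_append)
  qed
qed

text \<open>A new occurrence ends at the new letter and has a single free index: the start of the
  adjacent pair for \<open>Underline12\<close>, the first position for
  \<open>Underline23\<close>.\<close>

lemma oc_snoc: "oc p (e @ [c]) = oc p e + new_occ p (rev e) c"
proof -
  let ?N = "{{i1, i2, length e} | i1 i2. i1 < i2 \<and> i2 < length e \<and>
        reduction [e ! i1, e ! i2, c] = letters p \<and> adjacency p i1 i2 (length e)}"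
  have "card ?N = new_occ p (rev e) c"
  proof (cases p)
    case (Underline12 w)
    let ?I = "{i. Suc i < length e \<and> reduction [e ! i, e ! Suc i, c] = w}"
    have "?N = (\<lambda>i. {i, Suc i, length e}) ` ?I"
      using Underline12 by (auto simp: image_iff)
    moreover have "inj_on (\<lambda>i. {i, Suc i, length e}) ?I"
    proof (rule inj_onI)
      fix i j assume "i \<in> ?I" "j \<in> ?I" and eq: "{i, Suc i, length e} = {j, Suc j, length e}"
      then have "Suc i < length e" "Suc j < length e" by simp_all
      moreover have "Min {k, Suc k, length e} = k" if "Suc k < length e" for k
        using that by simp
      ultimately show "i = j" using eq by metis
    qed
    ultimately show ?thesis
      using Underline12 new_occ12 by (simp add: card_image)
  next
    case (Underline23 w)
    show ?thesis
    proof (cases e rule: rev_cases)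
      case Nil
      then show ?thesis using Underline23 by simp
    next
      case (snoc e' b)
      let ?I = "{i. i < length e' \<and> reduction [e' ! i, b, c] = w}"
      have "?N = (\<lambda>i. {i, length e', length e}) ` ?I"
        using Underline23 snoc by (auto simp: image_iff nth_append)
      moreover have "inj_on (\<lambda>i. {i, length e', length e}) ?I"
        using snoc by (auto simp: inj_on_def doubleton_eq_iff insert_eq_iff)
      moreover have "new_occ p (rev e) c = card ?I"
      proof -
        have "length (filter P (rev e')) = length (filter P e')" for P
          by (metis length_rev rev_filter)
        then show ?thesis
          using Underline23 snoc by (simp add: length_filter_conv_card[of _ e'])
      qed
      ultimately show ?thesis
        by (simp add: card_image)
    qed
  qed
  moreover have "length e \<notin> A" if "A \<in> occurrences p e" for A
    using that by (auto simp: occurrences_def)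
  then have "occurrences p e \<inter> ?N = {}"
    by blast
  moreover have "finite ?N"
    using finite_occurrences[of p "e @ [c]"] unfolding occurrences_snoc by simp
  ultimately show ?thesis
    unfolding oc_def occurrences_snoc by (simp add: card_Un_disjoint finite_occurrences)
qed

text \<open>The words \<open>w\<close> are sorted by their first letter, which then joins the
  prefix. Measuring \<open>m\<close> relative to the prefix lets the induction run over all
  \<open>r\<close>.\<close>

lemma card_extensions:
  "card {w. length w = k \<and> (\<forall>i<k. w ! i \<le> length r + i) \<and> oc p (rev r @ w) = oc p (rev r) + m} =
     count_ext p k r m"
proof (induction k arbitrary: r m)
  case 0
  have "{w. length w = 0 \<and> (\<forall>i<0. w ! i \<le> length r + i) \<and>
      oc p (rev r @ w) = oc p (rev r) + m} = (if m = 0 then {[]} else {})"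
    by auto
  then show ?case by simp
next
  case (Suc k)
  let ?E = "\<lambda>k r x. {w. length w = k \<and> (\<forall>i<k. w ! i \<le> length r + i) \<and> oc p (rev r @ w) = x}"
  let ?x = "oc p (rev r) + m"
  have fin: "finite (?E k r x)" for k r x
  proof (rule finite_subset)
    show "?E k r x \<subseteq> {w. set w \<subseteq> {..length r + k} \<and> length w = k}"
      by (force simp: in_set_conv_nth)
  qed (rule finite_lists_length_eq, simp)
  have split: "?E (Suc k) r ?x = (\<Union>v\<le>length r. (#) v ` ?E k (v # r) ?x)"
  proof (intro equalityI subsetI)
    fix w assume w: "w \<in> ?E (Suc k) r ?x"
    then obtain v u where "w = v # u" by (cases w) auto
    with w show "w \<in> (\<Union>v\<le>length r. (#) v ` ?E k (v # r) ?x)"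
      by (auto simp: All_less_Suc2)
  next
    fix w assume "w \<in> (\<Union>v\<le>length r. (#) v ` ?E k (v # r) ?x)"
    then show "w \<in> ?E (Suc k) r ?x"
      by (auto simp: All_less_Suc2)
  qed
  have "card (?E (Suc k) r ?x) = (\<Sum>v\<le>length r. card ((#) v ` ?E k (v # r) ?x))"
    unfolding split 
  proof (rule card_UN_disjoint)
    show "\<forall>v\<in>{..length r}. finite ((#) v ` ?E k (v # r) ?x)"
      by (intro ballI finite_imageI fin)
  qed auto
  also have "\<dots> = (\<Sum>v\<le>length r. card (?E k (v # r) ?x))"
    by (simp add: card_image)
  also have "\<dots> = count_ext p (Suc k) r m"
  proof -
    have "card (?E k (v # r) ?x) =
        (if new_occ p r v \<le> m then count_ext p k (v # r) (m - new_occ p r v) else 0)" for v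
    proof (cases "new_occ p r v \<le> m")
      case True
      then have "?x = oc p (rev (v # r)) + (m - new_occ p r v)"
        using oc_snoc[of p "rev r" v] by simp
      then show ?thesis
        using Suc.IH[of "v # r" "m - new_occ p r v"] True by simp
    next
      case False
      \<comment> \<open>Occurrences survive every extension, so a letter that creates more than
        \<open>m\<close> of them contributes nothing.\<close>
      have mono: "oc p e \<le> oc p (e @ w)" for e w
        by (induction w rule: rev_induct) (simp_all add: oc_snoc flip: append_assoc)
      have "oc p (rev (v # r) @ w) \<noteq> ?x" for w
        using False oc_snoc[of p "rev r" v] mono[of "rev (v # r)" w] by simp
      then show ?thesis using False by simp
    qed
    then show ?thesis by simp
  qed
  finally show ?case .
qed

lemma card_inv_seqs_oc: "card (inv_seqs_oc n p m) = count_ext p n [] m"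
  using card_extensions[of n "[]" p m]
  by (simp add: inv_seqs_oc_def inv_seqs_def oc_Nil conj_assoc)

lemma wilf_equiv_iff: "wilf_equiv p q \<longleftrightarrow> (\<forall>n. count_ext p n [] 0 = count_ext q n [] 0)"
  by (simp add: wilf_equiv_def inv_seqs_avoid_def card_inv_seqs_oc)

subsection \<open>Equal generating trees\<close>

definition allowed :: "vincular \<Rightarrow> nat list \<Rightarrow> nat set" where
  "allowed p r = {v. v \<le> length r \<and> new_occ p r v = 0}"

lemma finite_allowed [simp]: "finite (allowed p r)"
  by (simp add: allowed_def)

lemma count_ext_Suc_0: "count_ext p (Suc k) r 0 = (\<Sum>v\<in>allowed p r. count_ext p k (v # r) 0)"
proof -
  have "allowed p r = {v \<in> {..length r}. new_occ p r v = 0}"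
    by (auto simp: allowed_def)
  then have "sum f (allowed p r) = (\<Sum>v\<le>length r. if new_occ p r v = 0 then f v else 0)"
    for f :: "nat \<Rightarrow> nat"
    by (simp only: sum.inter_filter[OF finite_atMost])
  then show ?thesis by (auto intro!: sum.cong)
qed

lemma new_occ12_eq_0:
  assumes "\<And>a b c. reduction [a, b, c] = w \<Longrightarrow> c = a \<or> c = b" "c \<notin> set r"
  shows "new_occ (Underline12 w) r c = 0"
  using assms(2)
proof (induction r rule: induct_list012)
  case (3 x y zs)
  then show ?case using assms(1)[of y x c] by auto
qed simp_all

text \<open>Appending \<open>v\<close> creates one new adjacent pair, \<open>a\<close> followed by
  \<open>v\<close>, and forbids only the letters completing it. The next position also admits one
  letter larger than all letters so far; it is unrestricted because the third letter of
  \<open>w\<close> repeats an earlier one.\<close>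

lemma allowed_Cons:
  assumes "\<And>a b c. reduction [a, b, c] = w \<Longrightarrow> c = a \<or> c = b"
    and "\<forall>x \<in> set (a # r). x < length (a # r)" "v \<in> allowed (Underline12 w) (a # r)"
  shows "allowed (Underline12 w) (v # a # r) =
    insert (Suc (length (a # r))) (allowed (Underline12 w) (a # r)) - {c. reduction [a, v, c] = w}"
proof -
  have "new_occ (Underline12 w) (a # r) (Suc (length (a # r))) = 0"
    by (rule new_occ12_eq_0) (use assms in fastforce)+
  then show ?thesis
    by (auto simp: allowed_def le_Suc_eq)
qed

section \<open>Ranks within the set of available letters\<close>

definition rank :: "nat set \<Rightarrow> nat \<Rightarrow> nat" where
  "rank A v = card {u \<in> A. u < v}"

lemma rank_less_iff:
  assumes "finite A" "v \<in> A"
  shows "rank A v < rank A a \<longleftrightarrow> v < a"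
proof
  assume "rank A v < rank A a"
  then show "v < a"
    using card_mono[of "{u \<in> A. u < v}" "{u \<in> A. u < a}"] assms
    by (intro ccontr[of "v < a"]) (force simp: rank_def)
next
  assume "v < a"
  then show "rank A v < rank A a"
    unfolding rank_def using assms by (intro psubset_card_mono) auto
qed

text \<open>\<open>rank A\<close> is a bijection from \<open>A\<close> onto
  \<open>{..<card A}\<close>; this turns a sum over available letters into the sums of the trees
  below.\<close>

lemma sum_by_rank:
  assumes "finite A" "\<And>v. v \<in> A \<Longrightarrow> f v = g (rank A v)"
  shows "sum f A = (\<Sum>j<card A. g j)"
proof -
  have inj: "inj_on (rank A) A"
    using rank_less_iff[OF assms(1)] by (metis inj_onI linorder_neqE_nat less_irrefl)
  have "rank A v < card A" if "v \<in> A" for v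
    unfolding rank_def using that assms(1) by (intro psubset_card_mono) auto
  then have "rank A ` A \<subseteq> {..<card A}" by auto
  then have "rank A ` A = {..<card A}"
    using card_image[OF inj] by (intro card_subset_eq) auto
  then show ?thesis
    using sum.reindex[OF inj, of g] assms(2) by simp
qed

lemma rank_insert: "v \<le> N \<Longrightarrow> rank (insert N A) v = rank A v"
  unfolding rank_def by (rule arg_cong[where f = card]) auto

lemma rank_remove:
  assumes "finite A" "x \<in> A"
  shows "rank (A - {x}) v = rank A v - of_bool (x < v)"
proof (cases "x < v")
  case True
  then have "{u \<in> A - {x}. u < v} = {u \<in> A. u < v} - {x}" by auto
  then show ?thesis using assms True by (simp add: rank_def)
next
  case False
  then have "{u \<in> A - {x}. u < v} = {u \<in> A. u < v}" by auto
  then show ?thesis using False by (simp add: rank_def)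
qed

text \<open>\<open>s\<close> is the number of available letters, \<open>r\<close> the rank of the
  last one. An ascent gains one letter and loses one, so \<open>s\<close> stays; the shift
  \<open>j - 1\<close> reflects, for 01-0, that the lost letter lies below the new last
  letter.\<close>

fun asc_tree :: "nat \<Rightarrow> nat \<Rightarrow> nat \<Rightarrow> nat" where
  "asc_tree 0 s r = 1"
| "asc_tree (Suc k) s r = (\<Sum>j<s. if r < j then asc_tree k s (j - 1) else asc_tree k (Suc s) j)"

text \<open>In a descent the lost letter is not below the new last letter, so the rank
  \<open>j\<close> is kept.\<close>

fun desc_tree :: "nat \<Rightarrow> nat \<Rightarrow> nat \<Rightarrow> nat" where
  "desc_tree 0 s r = 1"
| "desc_tree (Suc k) s r = (\<Sum>j<s. if j < r then desc_tree k s j else desc_tree k (Suc s) j)"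

context
  fixes r :: "nat list" and p :: vincular and A :: "nat set" and N :: nat
  assumes bounded: "\<forall>x \<in> set r. x < length r"
  defines "A \<equiv> allowed p r" and "N \<equiv> Suc (length r)"
begin

lemma allowed_facts: "finite A" "N \<notin> A" "v \<in> A \<Longrightarrow> v \<le> length r"
  by (auto simp: A_def N_def allowed_def)

lemma bounded_Cons: "v \<in> A \<Longrightarrow> \<forall>x \<in> set (v # r). x < length (v # r)"
  using bounded by (auto simp: A_def allowed_def)

lemma card_rank_insert:
  assumes "v \<in> A"
  shows "card (insert N A) = Suc (card A)" "rank (insert N A) v = rank A v"
  using assms allowed_facts by (auto simp: N_def intro!: rank_insert le_SucI)

lemma card_rank_exchange:
  assumes "v \<in> A" "x \<in> A"
  shows "card (insert N A - {x}) = card A"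
    "rank (insert N A - {x}) v = rank A v - of_bool (x < v)"
  using assms allowed_facts card_rank_insert[of v] by (simp_all add: rank_remove card_Diff_singleton)

end

text \<open>An ascent from \<open>a\<close> to \<open>v\<close> forbids \<open>a\<close> but not
  \<open>v\<close>, so the last letter always remains available and its rank drops by one.\<close>

lemma count_ext_010:
  assumes "\<forall>x \<in> set (a # r). x < length (a # r)" "a \<in> allowed (Underline12 [0, 1, 0]) (a # r)"
  shows "count_ext (Underline12 [0, 1, 0]) k (a # r) 0 =
    asc_tree k (card (allowed (Underline12 [0, 1, 0]) (a # r)))
      (rank (allowed (Underline12 [0, 1, 0]) (a # r)) a)"
  using assms
proof (induction k arbitrary: a r)
  case 0
  then show ?case by simp
next
  case (Suc k)
  let ?p = "Underline12 [0, 1, 0]"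
  let ?A = "allowed ?p (a # r)" and ?N = "Suc (length (a # r))"
  have "count_ext ?p k (v # a # r) 0 =
      (if rank ?A a < rank ?A v then asc_tree k (card ?A) (rank ?A v - 1)
       else asc_tree k (Suc (card ?A)) (rank ?A v))" if v: "v \<in> ?A" for v
  proof -
    have A': "allowed ?p (v # a # r) = (if a < v then insert ?N ?A - {a} else insert ?N ?A)"
      using allowed_Cons[of "[0, 1, 0]" a r v] Suc.prems(1) v by (auto simp: reduction_eq_simps)
    have "v \<in> allowed ?p (v # a # r)"
      unfolding A' using v by auto
    note IH = Suc.IH[OF bounded_Cons[OF Suc.prems(1) v] this]
    show ?thesis
      unfolding IH A'
      using v Suc.prems card_rank_insert[OF Suc.prems(1), where p = ?p and v = v]
        card_rank_exchange[OF Suc.prems(1), where p = ?p and v = v and x = a]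
      by (simp add: rank_less_iff)
  qed
  then show ?case
    unfolding count_ext_Suc_0 asc_tree.simps desc_tree.simps
    by (rule sum_by_rank[OF finite_allowed])
qed

text \<open>A forbidden last letter of rank \<open>i\<close> has the same descendants as an allowed one of rank \<open>i - 1\<close>.\<close>

lemma count_ext_011:
  assumes "\<forall>x \<in> set (a # r). x < length (a # r)"
    and "A = allowed (Underline12 [0, 1, 1]) (a # r)" "a \<in> A \<or> 0 < rank A a"
  shows "count_ext (Underline12 [0, 1, 1]) k (a # r) 0 =
    asc_tree k (card A) (if a \<in> A then rank A a else rank A a - 1)"
  using assms
proof (induction k arbitrary: a r A)
  case 0
  then show ?case by simp
next
  case (Suc k)
  let ?p = "Underline12 [0, 1, 1]" and ?N = "Suc (length (a # r))"
  let ?i = "if a \<in> A then rank A a else rank A a - 1"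
  note A = Suc.prems(2)
  have fin: "finite A" using A by simp
  have "count_ext ?p k (v # a # r) 0 =
      (if ?i < rank A v then asc_tree k (card A) (rank A v - 1)
       else asc_tree k (Suc (card A)) (rank A v))" if v: "v \<in> A" for v
  proof -
    have A': "allowed ?p (v # a # r) = (if a < v then insert ?N A - {v} else insert ?N A)"
      using allowed_Cons[of "[0, 1, 1]" a r v] Suc.prems(1) v A by (auto simp: reduction_eq_simps)
    \<comment> \<open>If \<open>a\<close> is forbidden, the available letters above it are those of
      rank at least \<open>rank A a\<close>; the strict comparison with \<open>rank A a - 1\<close>
      says the same, as \<open>rank A a\<close> is positive.\<close>
    have less: "?i < rank A v \<longleftrightarrow> a < v"
    proof (cases "a \<in> A")
      case True
      then show ?thesis using rank_less_iff[OF fin True] by simp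
    next
      case False
      then have "a \<noteq> v" using v by auto
      then show ?thesis using rank_less_iff[OF fin v, of a] False Suc.prems(3) by auto
    qed
    note IH = Suc.IH[OF bounded_Cons[OF Suc.prems(1) v[unfolded A]] refl]
    note ranks = card_rank_insert[OF Suc.prems(1), where p = ?p and v = v, folded A]
      card_rank_exchange[OF Suc.prems(1), where p = ?p and v = v and x = v, folded A]
    show ?thesis
    proof (cases "a < v")
      case True
      \<comment> \<open>After this ascent \<open>v\<close> is forbidden, and the induction
        hypothesis requires its rank to be positive.\<close>
      then have "0 < rank A v" using less by linarith
      then show ?thesis
        using IH True less v ranks unfolding A' by simp
    next
      case False
      then show ?thesis
        using IH less v ranks unfolding A' by simp
    qed
  qed
  then show ?case
    unfolding count_ext_Suc_0 asc_tree.simps desc_tree.simps Suc.prems(2)[symmetric]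
    by (rule sum_by_rank[OF fin])
qed

text \<open>A descent from \<open>a\<close> to \<open>v\<close> forbids \<open>a\<close>, which lies
  above \<open>v\<close>; hence \<open>v\<close> stays available with the same rank.\<close>

lemma count_ext_101:
  assumes "\<forall>x \<in> set (a # r). x < length (a # r)" "a \<in> allowed (Underline12 [1, 0, 1]) (a # r)"
  shows "count_ext (Underline12 [1, 0, 1]) k (a # r) 0 =
    desc_tree k (card (allowed (Underline12 [1, 0, 1]) (a # r)))
      (rank (allowed (Underline12 [1, 0, 1]) (a # r)) a)"
  using assms
proof (induction k arbitrary: a r)
  case 0
  then show ?case by simp
next
  case (Suc k)
  let ?p = "Underline12 [1, 0, 1]"
  let ?A = "allowed ?p (a # r)" and ?N = "Suc (length (a # r))"
  have "count_ext ?p k (v # a # r) 0 =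
      (if rank ?A v < rank ?A a then desc_tree k (card ?A) (rank ?A v)
       else desc_tree k (Suc (card ?A)) (rank ?A v))" if v: "v \<in> ?A" for v
  proof -
    have A': "allowed ?p (v # a # r) = (if v < a then insert ?N ?A - {a} else insert ?N ?A)"
      using allowed_Cons[of "[1, 0, 1]" a r v] Suc.prems(1) v by (auto simp: reduction_eq_simps)
    have "v \<in> allowed ?p (v # a # r)"
      unfolding A' using v by auto
    note IH = Suc.IH[OF bounded_Cons[OF Suc.prems(1) v] this]
    show ?thesis
      unfolding IH A'
      using v Suc.prems card_rank_insert[OF Suc.prems(1), where p = ?p and v = v]
        card_rank_exchange[OF Suc.prems(1), where p = ?p and v = v and x = a]
      by (simp add: rank_less_iff)
  qed
  then show ?case
    unfolding count_ext_Suc_0 asc_tree.simps desc_tree.simps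
    by (rule sum_by_rank[OF finite_allowed])
qed

text \<open>A descent forbids the new letter itself without changing its rank. An available
  \<open>v\<close> lies below \<open>a\<close> iff its rank does, even when \<open>a\<close> is
  forbidden, so no shift arises here.\<close>

lemma count_ext_100:
  assumes "\<forall>x \<in> set (a # r). x < length (a # r)"
  shows "count_ext (Underline12 [1, 0, 0]) k (a # r) 0 =
    desc_tree k (card (allowed (Underline12 [1, 0, 0]) (a # r)))
      (rank (allowed (Underline12 [1, 0, 0]) (a # r)) a)"
  using assms
proof (induction k arbitrary: a r)
  case 0
  then show ?case by simp
next
  case (Suc k)
  let ?p = "Underline12 [1, 0, 0]"
  let ?A = "allowed ?p (a # r)" and ?N = "Suc (length (a # r))"
  have "count_ext ?p k (v # a # r) 0 =
      (if rank ?A v < rank ?A a then desc_tree k (card ?A) (rank ?A v)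
       else desc_tree k (Suc (card ?A)) (rank ?A v))" if v: "v \<in> ?A" for v
  proof -
    have A': "allowed ?p (v # a # r) = (if v < a then insert ?N ?A - {v} else insert ?N ?A)"
      using allowed_Cons[of "[1, 0, 0]" a r v] Suc.prems(1) v by (auto simp: reduction_eq_simps)
    note IH = Suc.IH[OF bounded_Cons[OF Suc.prems v]]
    show ?thesis
      unfolding IH A'
      using v Suc.prems card_rank_insert[OF Suc.prems, where p = ?p and v = v]
        card_rank_exchange[OF Suc.prems, where p = ?p and v = v and x = v]
      by (simp add: rank_less_iff)
  qed
  then show ?case
    unfolding count_ext_Suc_0 asc_tree.simps desc_tree.simps
    by (rule sum_by_rank[OF finite_allowed])
qed

lemma wilf_equiv12I:
  assumes "\<And>k. count_ext (Underline12 w) k [0] 0 = count_ext (Underline12 w') k [0] 0"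
  shows "wilf_equiv (Underline12 w) (Underline12 w')"
  unfolding wilf_equiv_iff
proof
  fix n
  show "count_ext (Underline12 w) n [] 0 = count_ext (Underline12 w') n [] 0"
    using assms by (cases n) simp_all
qed

lemma allowed_singleton: "allowed (Underline12 w) [0] = {0, 1}"
  by (auto simp: allowed_def)

lemma wilf_equiv_010_011: "wilf_equiv (Underline12 [0, 1, 0]) (Underline12 [0, 1, 1])"
proof (rule wilf_equiv12I)
  fix k
  show "count_ext (Underline12 [0, 1, 0]) k [0] 0 = count_ext (Underline12 [0, 1, 1]) k [0] 0"
    using count_ext_010[of 0 "[]" k] count_ext_011[OF _ refl, of 0 "[]" k]
    unfolding allowed_singleton by simp
qed

lemma wilf_equiv_100_101: "wilf_equiv (Underline12 [1, 0, 0]) (Underline12 [1, 0, 1])"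
proof (rule wilf_equiv12I)
  fix k
  show "count_ext (Underline12 [1, 0, 0]) k [0] 0 = count_ext (Underline12 [1, 0, 1]) k [0] 0"
    using count_ext_100[of 0 "[]" k] count_ext_101[of 0 "[]" k]
    unfolding allowed_singleton by simp
qed

text \<open>A letter below the maximum \<open>M\<close> of the prefix must be followed by one that is not larger
  (2-01), resp. not smaller (2-10), or by one \<open>\<ge> M\<close>; the reflection \<open>v \<mapsto> M - 1 - v\<close> of the
  letters below \<open>M\<close> exchanges both conditions.\<close>

lemma count_ext_201_210:
  assumes "\<forall>x \<in> set (b # s). x \<le> M" "M \<in> set (b # s)" "M \<le> length (b # s)"
    and "\<forall>x \<in> set (b' # t). x \<le> M" "M \<in> set (b' # t)" "length t = length s"
    and "b' = (if b < M then M - 1 - b else M)"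
  shows "count_ext (Underline23 [2, 0, 1]) k (b # s) 0 =
    count_ext (Underline23 [2, 1, 0]) k (b' # t) 0"
  using assms
proof (induction k arbitrary: b s b' t M)
  case 0
  then show ?case by simp
next
  case (Suc k)
  let ?p = "Underline23 [2, 0, 1]" and ?q = "Underline23 [2, 1, 0]" and ?n = "length (b # s)"
  let ?f = "\<lambda>v. if v < M then M - 1 - v else v"
  have b: "b \<le> M" using Suc.prems(1) by simp
  \<comment> \<open>If \<open>b < M\<close>, then \<open>M\<close> occurs in \<open>s\<close> and is
    the best candidate for the letter 2, so exactly the letters strictly between \<open>b\<close>
    and \<open>M\<close> are forbidden; if \<open>b = M\<close>, nothing is.\<close>
  have p: "v \<in> allowed ?p (b # s) \<longleftrightarrow> v \<le> ?n \<and> (v \<le> b \<or> M \<le> v)" for v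
    using Suc.prems(1,2) by (force simp: allowed_def filter_empty_conv reduction_eq_simps)
  have q: "v \<in> allowed ?q (b' # t) \<longleftrightarrow> v \<le> ?n \<and> (b = M \<or> b' \<le> v)" for v
    using Suc.prems b by (force simp: allowed_def filter_empty_conv reduction_eq_simps)
  have "(\<Sum>v\<in>allowed ?p (b # s). count_ext ?p k (v # b # s) 0) =
    (\<Sum>v\<in>allowed ?q (b' # t). count_ext ?q k (v # b' # t) 0)"
  proof (rule sum.reindex_bij_witness[of _ ?f ?f])
    fix v assume v: "v \<in> allowed ?p (b # s)"
    show "?f v \<in> allowed ?q (b' # t)"
      using v Suc.prems(3,7) b unfolding p q by auto
    show "count_ext ?q k (?f v # b' # t) 0 = count_ext ?p k (v # b # s) 0"
    \<comment> \<open>A letter \<open>v \<ge> M\<close> is the new maximum and its own image; a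
      smaller one leaves the maximum, hence the reflection, unchanged.\<close>
    proof (rule Suc.IH[symmetric, of _ _ "max M v"])
      show "?f v = (if v < max M v then max M v - 1 - v else max M v)" by auto
    qed (use v[unfolded p] Suc.prems in \<open>auto simp: max_def\<close>)
  next
    fix v assume v: "v \<in> allowed ?q (b' # t)"
    show "?f v \<in> allowed ?p (b # s)"
      using v Suc.prems(3,7) b unfolding p q by (auto split: if_splits)
  qed auto
  then show ?case
    unfolding count_ext_Suc_0 .
qed

lemma wilf_equiv_201_210: "wilf_equiv (Underline23 [2, 0, 1]) (Underline23 [2, 1, 0])"
  unfolding wilf_equiv_iff
proof
  fix n
  show "count_ext (Underline23 [2, 0, 1]) n [] 0 = count_ext (Underline23 [2, 1, 0]) n [] 0"
    using count_ext_201_210[of 0 "[]" 0 0 "[]"] by (cases n) simp_all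
qed

subsection \<open>Rotation of gaps\<close>

text \<open>Each adjacent pair related by \<open>Q\<close> is weighted by the number of letters
  \<open>b\<close> strictly before it; \<open>c\<close> counts those already passed. With the two
  relations below this counts the occurrences of 1-01 and 1-10 whose repeated letter is
  \<open>b\<close>.\<close>

fun tally :: "(nat \<Rightarrow> nat \<Rightarrow> bool) \<Rightarrow> nat \<Rightarrow> nat \<Rightarrow> nat list \<Rightarrow> nat" where
  "tally Q b c (x # y # zs) =
     (if Q x y then c else 0) + tally Q b (c + of_bool (x = b)) (y # zs)"
| "tally Q b c zs = 0"

abbreviation asc_to :: "nat \<Rightarrow> nat \<Rightarrow> nat \<Rightarrow> bool" where
  "asc_to b x y \<equiv> x < b \<and> y = b"

abbreviation desc_from :: "nat \<Rightarrow> nat \<Rightarrow> nat \<Rightarrow> bool" where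
  "desc_from b x y \<equiv> x = b \<and> y < b"

text \<open>The pair at the seam is weighted with \<open>butlast xs\<close> because its first letter
  does not precede it.\<close>

lemma tally_append:
  "tally Q b c (xs @ ys) = tally Q b c xs
    + (if xs \<noteq> [] \<and> ys \<noteq> [] \<and> Q (last xs) (hd ys) then c + count_list (butlast xs) b else 0)
    + tally Q b (c + count_list xs b) ys"
proof (induction Q b c xs rule: tally.induct)
  case ("2_2" Q b c x)
  then show ?case by (cases ys) auto
qed auto

lemma tally_Cons:
  "tally Q b c (x # ys) =
    (if ys \<noteq> [] \<and> Q x (hd ys) then c else 0) + tally Q b (c + of_bool (x = b)) ys"
  by (cases ys) auto

lemma tally_sep:
  assumes "\<And>x. \<not> Q x s" "\<And>x. \<not> Q s x" "s \<noteq> b"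
  shows "tally Q b c (xs @ s # ys) = tally Q b c xs + tally Q b (c + count_list xs b) ys"
  using assms by (simp add: tally_append tally_Cons)

lemma tally_eq_0:
  assumes "\<And>x y. x \<in> set xs \<Longrightarrow> y \<in> set xs \<Longrightarrow> \<not> Q x y"
  shows "tally Q b c xs = 0"
  using assms by (induction Q b c xs rule: tally.induct) auto

lemma tally_map:
  assumes "\<And>x y. Q (h x) (h y) = Q x y" "\<And>x. h x = b \<longleftrightarrow> x = b"
  shows "tally Q b c (map h xs) = tally Q b c xs"
  using assms by (induction Q b c xs rule: tally.induct) auto

text \<open>Occurrences are sorted by their repeated value. A letter \<open>v\<close> appended after
  \<open>u\<close> affects only the summand \<open>b = v\<close> for 1-01 and \<open>b = u\<close>
  for 1-10.\<close>

lemma oc_eq_sum_tally: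
  assumes "\<forall>x \<in> set e. x < n"
  shows "oc (Underline23 [1, 0, 1]) e = (\<Sum>b<n. tally (asc_to b) b 0 e)"
    and "oc (Underline23 [1, 1, 0]) e = (\<Sum>b<n. tally (desc_from b) b 0 e)"
proof -
  have count: "length (filter (\<lambda>a. P \<and> a = v) (rev xs)) = (if P then count_list xs v else 0)"
    for P and v :: nat and xs
    by (induction xs) auto
  have "oc (Underline23 [1, 0, 1]) e = (\<Sum>b<n. tally (asc_to b) b 0 e) \<and>
    oc (Underline23 [1, 1, 0]) e = (\<Sum>b<n. tally (desc_from b) b 0 e)"
    using assms
  proof (induction e rule: rev_induct)
    case Nil
    then show ?case by (simp add: oc_Nil)
  next
    case (snoc v e)
    show ?case
    proof (cases e rule: rev_cases)
      case Nil
      then show ?thesis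
        using oc_snoc[of _ "[]" v] by (simp add: oc_Nil)
    next
      case e: (snoc e' u)
      have red: "reduction [a, u, v] = [1, 0, 1] \<longleftrightarrow> u < v \<and> a = v"
        "reduction [a, u, v] = [1, 1, 0] \<longleftrightarrow> v < u \<and> a = u" for a
        unfolding reduction_eq_iff by auto
      have "new_occ (Underline23 [1, 0, 1]) (rev e) v = (if u < v then count_list e' v else 0)"
        using count by (simp add: e red del: One_nat_def)
      moreover have "new_occ (Underline23 [1, 1, 0]) (rev e) v =
          (if v < u then count_list e' u else 0)"
        using count by (simp add: e red del: One_nat_def)
      moreover have "(\<Sum>b<n. if asc_to b u v then count_list e' b else 0) =
          (if u < v then count_list e' v else 0)"
        using sum.delta[of "{..<n}" v "\<lambda>b. if u < b then count_list e' b else 0"] snoc.prems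
        by (simp add: if_if_eq_conj conj_commute eq_commute)
      moreover have "(\<Sum>b<n. if desc_from b u v then count_list e' b else 0) =
          (if v < u then count_list e' u else 0)"
        using sum.delta[of "{..<n}" u "\<lambda>b. if v < b then count_list e' b else 0"] snoc.prems
        by (simp add: if_if_eq_conj conj_commute eq_commute e)
      moreover have "tally Q b 0 (e @ [v]) =
          tally Q b 0 e + (if Q u v then count_list e' b else 0)" for Q b
        using tally_append[of Q b 0 e "[v]"] by (simp add: e)
      moreover have "oc (Underline23 [1, 0, 1]) e = (\<Sum>b<n. tally (asc_to b) b 0 e)"
        "oc (Underline23 [1, 1, 0]) e = (\<Sum>b<n. tally (desc_from b) b 0 e)"
        using snoc by simp_all
      ultimately show ?thesis
        by (simp only: oc_snoc sum.distrib)
    qed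
  qed
  then show "oc (Underline23 [1, 0, 1]) e = (\<Sum>b<n. tally (asc_to b) b 0 e)"
    "oc (Underline23 [1, 1, 0]) e = (\<Sum>b<n. tally (desc_from b) b 0 e)"
    by simp_all
qed

section \<open>Words cut at their letters at least \<open>a\<close>, and the rotation of their
  gaps\<close>

lemma tally_of_less:
  assumes "\<forall>x \<in> set u. x < a"
  shows "tally (desc_from a) b c u = 0" "tally (asc_to a) b c u = 0"
    "count_list u a = 0" "count_list (butlast u) a = 0"
  using assms by (auto intro!: tally_eq_0 count_notin dest: in_set_butlastD)

lemma split_at_ge_induct [case_names small sep]:
  fixes a :: nat
  assumes "\<And>w. \<forall>x \<in> set w. x < a \<Longrightarrow> P w"
    and "\<And>g s r. \<forall>x \<in> set g. x < a \<Longrightarrow> a \<le> s \<Longrightarrow> P r \<Longrightarrow> P (g @ s # r)"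
  shows "P w"
proof (induction w rule: length_induct)
  case (1 w)
  show ?case
  proof (cases "dropWhile (\<lambda>x. x < a) w")
    case Nil
    then show ?thesis using assms(1) by (simp add: dropWhile_eq_Nil_conv)
  next
    case (Cons s r)
    have w: "w = takeWhile (\<lambda>x. x < a) w @ s # r"
      using Cons by (metis takeWhile_dropWhile_id)
    have "P r"
      using 1 arg_cong[OF w, of length] by simp
    moreover have "a \<le> s"
      using Cons by (simp add: dropWhile_eq_Cons_conv not_less)
    ultimately show ?thesis
      by (subst w) (rule assms(2), auto dest: set_takeWhileD)
  qed
qed

lemma split_at_ge_unique:
  fixes a :: nat
  assumes "g @ z = g' @ z'" "\<forall>x \<in> set g. x < a" "\<forall>x \<in> set g'. x < a"
    and "z = [] \<or> a \<le> hd z" "z' = [] \<or> a \<le> hd z'"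
  shows "g = g' \<and> z = z'"
proof -
  have "takeWhile (\<lambda>x. x < a) (u @ y) = u" if "\<forall>x \<in> set u. x < a" "y = [] \<or> a \<le> hd y" for u y
    using that by (cases y) (auto simp: takeWhile_append)
  then have "g = g'"
    using assms by metis
  then show ?thesis using assms(1) by simp
qed

lemma length_dropWhile_less: "dropWhile P w = s # r \<Longrightarrow> length r < length w"
  by (metis Suc_le_eq length_Cons length_dropWhile_le)

text \<open>Cut \<open>w\<close> at its letters \<open>\<ge> a\<close>.  Between two consecutive letters \<open>> a\<close> (or an end of the
  word), the sequence telling which of the gaps are nonempty is rotated by one place, while the
  contents of the nonempty gaps keep their order.  The rotation is performed by successive
  exchanges, from right to left.\<close>

function rot :: "nat \<Rightarrow> nat list \<Rightarrow> nat list" where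
  "rot a w = (case dropWhile (\<lambda>x. x < a) w of [] \<Rightarrow> w
     | s # r \<Rightarrow>
         let g = takeWhile (\<lambda>x. x < a) w;
             y = takeWhile (\<lambda>x. x < a) (rot a r);
             z = dropWhile (\<lambda>x. x < a) (rot a r)
         in if s = a \<and> (g = [] \<longleftrightarrow> y \<noteq> []) then y @ s # g @ z else g @ s # y @ z)"
  by pat_completeness auto
termination
  by (relation "measure (\<lambda>(a, w). length w)") (auto dest: length_dropWhile_less)

declare rot.simps [simp del]

lemma rot_small: "\<forall>x \<in> set w. x < a \<Longrightarrow> rot a w = w"
  by (subst rot.simps) (simp add: dropWhile_eq_Nil_conv[THEN iffD2])

text \<open>A single exchange: \<open>y\<close> is the first gap of the rotated rest, and it trades
  places with \<open>g\<close> across \<open>s = a\<close> when exactly one of them is empty. Two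
  nonempty gaps stay put, since exchanging them would only disturb the order of their
  contents.\<close>

lemma rot_sep:
  assumes "\<forall>x \<in> set g. x < a" "a \<le> s"
  obtains y z where "rot a r = y @ z" "\<forall>x \<in> set y. x < a" "z = [] \<or> a \<le> hd z"
    "rot a (g @ s # r) =
       (if s = a \<and> (g = [] \<longleftrightarrow> y \<noteq> []) then y @ s # g @ z else g @ s # y @ z)"
proof
  let ?y = "takeWhile (\<lambda>x. x < a) (rot a r)" and ?z = "dropWhile (\<lambda>x. x < a) (rot a r)"
  show "rot a r = ?y @ ?z" by simp
  show "\<forall>x \<in> set ?y. x < a" by (auto dest: set_takeWhileD)
  show "?z = [] \<or> a \<le> hd ?z"
    by (metis hd_dropWhile dropWhile_eq_Nil_conv not_less)
  have "dropWhile (\<lambda>x. x < a) (g @ s # r) = s # r" "takeWhile (\<lambda>x. x < a) (g @ s # r) = g"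
    using assms by (simp_all add: dropWhile_append takeWhile_append)
  then show "rot a (g @ s # r) =
       (if s = a \<and> (g = [] \<longleftrightarrow> ?y \<noteq> []) then ?y @ s # g @ ?z else g @ s # ?y @ ?z)"
    by (subst rot.simps) (simp add: Let_def)
qed

text \<open>Raising the letters below \<open>a\<close> to \<open>a\<close> makes an exchange across
  \<open>a\<close> invisible. So length and the positions of all letters above \<open>a\<close> are
  preserved.\<close>

lemma map_max_rot: "map (max a) (rot a w) = map (max a) w"
proof (induction w rule: split_at_ge_induct[where a = a])
  case (small w)
  then show ?case by (simp add: rot_small)
next
  case (sep g s r)
  have const: "map (max a) u = replicate (length u) a" if "\<forall>x \<in> set u. x < a" for u
    using that by (induction u) auto
  obtain y z where yz: "rot a r = y @ z" "\<forall>x \<in> set y. x < a"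
    "rot a (g @ s # r) = (if s = a \<and> (g = [] \<longleftrightarrow> y \<noteq> []) then y @ s # g @ z else g @ s # y @ z)"
    using rot_sep[OF sep(1,2)] by blast
  have "map (max a) r = map (max a) y @ map (max a) z"
    using sep(3) by (simp add: yz(1))
  moreover have "map (max a) (u @ a # v) = a # map (max a) u @ map (max a) v"
    if "\<forall>x \<in> set u. x < a" for u v
    using const[OF that] by (simp add: replicate_app_Cons_same)
  note this[OF sep(1)] this[OF yz(2)]
  ultimately show ?case
    unfolding yz(3) by (cases "g = []"; cases "y = []") simp_all
qed

text \<open>After the exchange, the gap behind \<open>s = a\<close> is nonempty iff the gap
  \<open>g\<close> before it was, so each \<open>a\<close> contributes to 1-10 what it contributed
  to 1-01.\<close>

lemma tally_rot_self: "tally (desc_from a) a c (rot a w) = tally (asc_to a) a c w"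
proof (induction w arbitrary: c rule: split_at_ge_induct[where a = a])
  case (small w)
  then show ?case by (simp add: rot_small tally_of_less)
next
  case (sep g s r)
  have last: "last u < a" if "\<forall>x \<in> set u. x < a" "u \<noteq> []" for u
    using that by simp
  have hd: "hd u < a" if "\<forall>x \<in> set u. x < a" "u \<noteq> []" for u
    using that by (simp add: hd_in_set)
  obtain y z where yz: "rot a r = y @ z" "\<forall>x \<in> set y. x < a" "z = [] \<or> a \<le> hd z"
    "rot a (g @ s # r) = (if s = a \<and> (g = [] \<longleftrightarrow> y \<noteq> []) then y @ s # g @ z else g @ s # y @ z)"
    using rot_sep[OF sep(1,2)] by blast
  have drop: "tally (desc_from a) a c (u @ z) = tally (desc_from a) a c z"
    if "\<forall>x \<in> set u. x < a" for u c
    using tally_of_less[OF that] last[OF that] by (auto simp: tally_append)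
  have z: "tally (desc_from a) a c z = tally (asc_to a) a c r" for c
    using sep(3)[of c] drop[OF yz(2)] by (simp add: yz(1))
  have desc: "tally (desc_from a) a c (u @ s # v @ z) =
      (if s = a \<and> v \<noteq> [] then c else 0) + tally (asc_to a) a (c + of_bool (s = a)) r"
    if u: "\<forall>x \<in> set u. x < a" and v: "\<forall>x \<in> set v. x < a" for u v
    using tally_of_less[OF u] last[OF u] hd[OF v] yz(3) sep(2) drop[OF v] z
    by (auto simp: tally_append[of _ _ _ u] tally_Cons hd_append)
  have "tally (asc_to a) a c (g @ s # r) =
      (if s = a \<and> g \<noteq> [] then c else 0) + tally (asc_to a) a (c + of_bool (s = a)) r"
    using tally_of_less[OF sep(1)] last[OF sep(1)] sep(2) by (auto simp: tally_append tally_Cons)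
  moreover have "tally (desc_from a) a c (rot a (g @ s # r)) =
      (if s = a \<and> g \<noteq> [] then c else 0) + tally (asc_to a) a (c + of_bool (s = a)) r"
    using desc[OF yz(2) sep(1)] desc[OF sep(1) yz(2)] unfolding yz(4) by auto
  ultimately show ?case by simp
qed

text \<open>Letters at least \<open>a\<close> belong to no pair of \<open>Q\<close> and differ from
  \<open>b\<close>, so the tally depends only on the nonempty gaps in order. An exchange moves a
  separator past a gap but keeps that order.\<close>

lemma tally_rot_less:
  assumes "b < a" "\<And>x y. Q x y \<Longrightarrow> x \<le> b \<and> y \<le> b"
  shows "tally Q b c (rot a w) = tally Q b c w"
proof (induction w arbitrary: c rule: split_at_ge_induct[where a = a])
  case (small w)
  then show ?case by (simp add: rot_small)
next
  case (sep g s r)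
  obtain y z where yz: "rot a r = y @ z" "z = [] \<or> a \<le> hd z"
    "rot a (g @ s # r) = (if s = a \<and> (g = [] \<longleftrightarrow> y \<noteq> []) then y @ s # g @ z else g @ s # y @ z)"
    using rot_sep[OF sep(1,2)] by blast
  have cut: "tally Q b c (u @ t # v) = tally Q b c u + tally Q b (c + count_list u b) v"
    if "a \<le> t" for u t v c
  proof -
    have "\<not> Q x t" "\<not> Q t x" for x
      using assms that by (meson leD less_le_trans)+
    then show ?thesis using assms(1) that by (simp add: tally_sep)
  qed
  have cut0: "tally Q b c (t # v) = tally Q b c v" if "a \<le> t" for t v c
    using cut[of t c "[]" v] that by simp
  have z: "tally Q b c (u @ z) = tally Q b c u + tally Q b (c + count_list u b) z" for u c
  proof (cases z)
    case (Cons t v)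
    then show ?thesis
      using yz(2) cut[of t c u v] cut[of t _ "[]" v] by simp
  qed simp
  have "tally Q b c (rot a (g @ s # r)) = tally Q b c (g @ s # y @ z)"
    using cut[OF sep(2)] cut0[OF sep(2)] z unfolding yz(3) by auto
  also have "\<dots> = tally Q b c (g @ s # r)"
    using cut[OF sep(2)] sep(3) by (simp flip: yz(1))
  finally show ?case .
qed

text \<open>The cut at the letters at least \<open>a\<close> is unique, and the exchange condition
  is symmetric in the two gaps, so the exchange can be undone.\<close>

lemma rot_inj: "rot a w = rot a w' \<Longrightarrow> w = w'"
proof (induction w arbitrary: w' rule: split_at_ge_induct[where a = a])
  case (small w)
  show ?case
  proof (rule split_at_ge_induct[where a = a and w = w' and
        P = "\<lambda>w'. rot a w = rot a w' \<longrightarrow> w = w'", THEN mp, OF _ _ small(2)], goal_cases)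
    case (1 w')
    then show ?case using small by (simp add: rot_small)
  next
    case (2 g s r)
    have "s \<in> set (rot a (g @ s # r))"
      by (rule rot_sep[OF 2(1,2), of r]) auto
    then show ?case using small 2(2) by (force simp: rot_small)
  qed
next
  case (sep g s r)
  show ?case
  proof (rule split_at_ge_induct[where a = a and w = w' and
        P = "\<lambda>w'. rot a (g @ s # r) = rot a w' \<longrightarrow> g @ s # r = w'", THEN mp, OF _ _ sep(4)],
      goal_cases)
    case (1 w')
    have "s \<in> set (rot a (g @ s # r))"
      by (rule rot_sep[OF sep(1,2), of r]) auto
    then show ?case using 1 sep(2) rot_small[OF 1] by (metis not_less)
  next
    case (2 g' s' r')
    show ?case
    proof
      assume eq: "rot a (g @ s # r) = rot a (g' @ s' # r')"
      obtain y z where yz: "rot a r = y @ z" "\<forall>x \<in> set y. x < a" "z = [] \<or> a \<le> hd z"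
        "rot a (g @ s # r) =
          (if s = a \<and> (g = [] \<longleftrightarrow> y \<noteq> []) then y @ s # g @ z else g @ s # y @ z)"
        using rot_sep[OF sep(1,2)] by blast
      obtain y' z' where yz': "rot a r' = y' @ z'" "\<forall>x \<in> set y'. x < a" "z' = [] \<or> a \<le> hd z'"
        "rot a (g' @ s' # r') =
          (if s' = a \<and> (g' = [] \<longleftrightarrow> y' \<noteq> []) then y' @ s' # g' @ z' else g' @ s' # y' @ z')"
        using rot_sep[OF 2(1,2)] by blast
      define G Y where "G = (if s = a \<and> (g = [] \<longleftrightarrow> y \<noteq> []) then y else g)"
        and "Y = (if s = a \<and> (g = [] \<longleftrightarrow> y \<noteq> []) then g else y)"
      note GY = this
      define G' Y' where "G' = (if s' = a \<and> (g' = [] \<longleftrightarrow> y' \<noteq> []) then y' else g')"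
        and "Y' = (if s' = a \<and> (g' = [] \<longleftrightarrow> y' \<noteq> []) then g' else y')"
      note GY' = this
      have "G @ s # Y @ z = G' @ s' # Y' @ z'"
      proof -
        have "rot a (g @ s # r) = G @ s # Y @ z" "rot a (g' @ s' # r') = G' @ s' # Y' @ z'"
          unfolding yz(4) yz'(4) GY GY' by simp_all
        then show ?thesis using eq by simp
      qed
      moreover have "\<forall>x \<in> set G. x < a" "\<forall>x \<in> set Y. x < a" "\<forall>x \<in> set G'. x < a"
        "\<forall>x \<in> set Y'. x < a"
        using sep(1) 2(1) yz(2) yz'(2) by (simp_all add: GY GY')
      ultimately have "G = G' \<and> s = s' \<and> Y = Y' \<and> z = z'"
        using split_at_ge_unique[of G "s # Y @ z" G' "s' # Y' @ z'" a]
          split_at_ge_unique[of Y z Y' z' a] sep(2) 2(2) yz(3) yz'(3) by simp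
      then have same: "G = G'" "Y = Y'" "s = s'" "z = z'" by simp_all
      have "g = g' \<and> y = y'"
        using same(1,2) unfolding GY GY' same(3) by metis
      moreover from this have "r = r'"
        using sep(3) yz(1) yz'(1) same(4) by simp
      ultimately show "g @ s # r = g' @ s' # r'" using same(3) by simp
    qed
  qed
qed

text \<open>In an inversion sequence the first gap contains the positions below \<open>a\<close>, which only letters
  below \<open>a\<close> can occupy; it therefore stays in place.\<close>

definition inv_rot :: "nat \<Rightarrow> nat list \<Rightarrow> nat list" where
  "inv_rot a e = (case dropWhile (\<lambda>x. x < a) e of [] \<Rightarrow> e
     | s # r \<Rightarrow> takeWhile (\<lambda>x. x < a) e @ s # rot a r)"

lemma inv_rot_small: "\<forall>x \<in> set e. x < a \<Longrightarrow> inv_rot a e = e"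
  by (simp add: inv_rot_def dropWhile_eq_Nil_conv[THEN iffD2])

lemma inv_rot_sep:
  "\<forall>x \<in> set g. x < a \<Longrightarrow> a \<le> s \<Longrightarrow> inv_rot a (g @ s # r) = g @ s # rot a r"
  by (simp add: inv_rot_def dropWhile_append takeWhile_append)

lemma map_max_inv_rot: "map (max a) (inv_rot a e) = map (max a) e"
  by (induction e rule: split_at_ge_induct[where a = a])
    (simp_all add: inv_rot_small inv_rot_sep map_max_rot)

lemma max_nth_inv_rot:
  assumes "i < length e"
  shows "max a (inv_rot a e ! i) = max a (e ! i)"
proof -
  have "length (inv_rot a e) = length e"
    using arg_cong[OF map_max_inv_rot, of length] by simp
  then show ?thesis
    using assms arg_cong[OF map_max_inv_rot, of "\<lambda>u. u ! i" a e] by simp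
qed

text \<open>The first \<open>a\<close> has weight 0 for both patterns, so keeping the first gap in
  place does no harm; this is why the count starts at 0.\<close>

lemma tally_inv_rot_self: "tally (desc_from a) a 0 (inv_rot a e) = tally (asc_to a) a 0 e"
proof (induction e rule: split_at_ge_induct[where a = a])
  case (small w)
  then show ?case by (simp add: inv_rot_small tally_of_less)
next
  case (sep g s r)
  then show ?case
    using tally_rot_self tally_of_less[OF sep(1)]
    by (auto simp: inv_rot_sep tally_append tally_Cons)
qed

lemma tally_inv_rot_less:
  assumes "b < a" "\<And>x y. Q x y \<Longrightarrow> x \<le> b \<and> y \<le> b"
  shows "tally Q b c (inv_rot a e) = tally Q b c e"
proof (induction e rule: split_at_ge_induct[where a = a])
  case (small w)
  then show ?case by (simp add: inv_rot_small)
next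
  case (sep g s r)
  have "\<not> Q x s" "\<not> Q s x" for x
    using assms sep(2) by (meson leD less_le_trans)+
  then show ?case
    using assms sep(1,2) tally_rot_less[of b a Q] by (simp add: inv_rot_sep tally_sep)
qed

text \<open>For \<open>b > a\<close>, raising letters below \<open>a\<close> to \<open>a\<close>
  changes neither being less than \<open>b\<close> nor being equal to \<open>b\<close>.\<close>

lemma tally_inv_rot_greater:
  assumes "a < b" "Q = asc_to b \<or> Q = desc_from b"
  shows "tally Q b c (inv_rot a e) = tally Q b c e"
proof -
  have "tally Q b c (map (max a) xs) = tally Q b c xs" for xs
    by (rule tally_map) (use assms in \<open>auto simp: max_def\<close>)
  then show ?thesis by (metis map_max_inv_rot)
qed

lemma inj_inv_rot: "inj (inv_rot a)"
proof (rule injI)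
  fix e e' assume "inv_rot a e = inv_rot a e'"
  then show "e = e'"
  proof (induction e rule: split_at_ge_induct[where a = a])
    case (small w)
    then show ?case
      by (induction e' rule: split_at_ge_induct[where a = a])
        (auto simp: inv_rot_small inv_rot_sep)
  next
    case (sep g s r)
    then show ?case
    proof (induction e' rule: split_at_ge_induct[where a = a])
      case (small w)
      then show ?case by (auto simp: inv_rot_small inv_rot_sep)
    next
      case (sep g' s' r')
      then have "g @ s # rot a r = g' @ s' # rot a r'"
        by (simp add: inv_rot_sep)
      then have "g = g' \<and> s # rot a r = s' # rot a r'"
        by (rule split_at_ge_unique) (use sep in auto)
      then show ?case using rot_inj by auto
    qed
  qed
qed

text \<open>The first letter \<open>s \<ge> a\<close> stands at a position at least
  \<open>s\<close>, so every later position \<open>i\<close> satisfies \<open>a \<le> i\<close>;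
  since only letters at most \<open>a\<close> are rearranged, the bound persists.\<close>

lemma inv_rot_in_inv_seqs:
  assumes "e \<in> inv_seqs n"
  shows "inv_rot a e \<in> inv_seqs n"
proof -
  have len: "length (inv_rot a e) = n"
    using arg_cong[OF map_max_inv_rot[of a e], of length] assms by (simp add: inv_seqs_def)
  have "inv_rot a e ! i \<le> i" if "i < n" for i
    using assms len
  proof (induction e rule: split_at_ge_induct[where a = a])
    case (small w)
    then show ?case using that by (simp add: inv_rot_small inv_seqs_def)
  next
    case (sep g s r)
    have le: "(g @ s # r) ! j \<le> j" if "j < n" for j
      using sep.prems(1) that by (simp add: inv_seqs_def)
    show ?case
    proof (cases "i \<le> length g")
      case True
      then show ?thesis
        using le[OF that] sep(1,2) by (cases "i = length g") (simp_all add: inv_rot_sep nth_append)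
    next
      case False
      have "length g < n"
        using sep.prems(1) by (auto simp: inv_seqs_def)
      with le[of "length g"] have "s \<le> length g" by simp
      then have "a \<le> i" using False sep(2) by simp
      moreover have "max a (inv_rot a (g @ s # r) ! i) = max a ((g @ s # r) ! i)"
        using sep.prems(1) that by (intro max_nth_inv_rot) (simp add: inv_seqs_def)
      ultimately show ?thesis
        using le[OF that] by linarith
    qed
  qed
  then show ?thesis using len by (simp add: inv_seqs_def)
qed

lemma finite_inv_seqs: "finite (inv_seqs n)"
proof (rule finite_subset)
  show "inv_seqs n \<subseteq> {w. set w \<subseteq> {..n} \<and> length w = n}"
    by (force simp: inv_seqs_def in_set_conv_nth)
qed (rule finite_lists_length_eq, simp)

lemma strongly_wilf_equiv_101_110:
  "strongly_wilf_equiv (Underline23 [1, 0, 1]) (Underline23 [1, 1, 0])"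
  unfolding strongly_wilf_equiv_def
proof (intro allI)
  fix n m
  \<comment> \<open>\<open>M k\<close> counts values below \<open>k\<close> by 1-01 and the others
    by 1-10, interpolating between the two statistics; \<open>inv_rot k\<close> converts the value
    \<open>k\<close> alone.\<close>
  define M where
    "M k e = (\<Sum>b<n. tally (if b < k then asc_to b else desc_from b) b 0 e)" for k e
  have step: "M (Suc k) e = M k (inv_rot k e)" for k e
    unfolding M_def
  proof (rule sum.cong[OF refl])
    fix b
    show "tally (if b < Suc k then asc_to b else desc_from b) b 0 e =
      tally (if b < k then asc_to b else desc_from b) b 0 (inv_rot k e)"
    proof (cases b k rule: linorder_cases)
      case less
      then show ?thesis using tally_inv_rot_less[of b k "asc_to b"] by simp
    next
      case equal
      then show ?thesis using tally_inv_rot_self by simp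
    next
      case greater
      then show ?thesis using tally_inv_rot_greater[of k b "desc_from b"] by simp
    qed
  qed
  have "card {e \<in> inv_seqs n. M k e = m} = card {e \<in> inv_seqs n. M 0 e = m}" for k
  proof (induction k)
    case (Suc k)
    have onto: "inv_rot k ` inv_seqs n = inv_seqs n"
      by (rule endo_inj_surj[OF finite_inv_seqs])
        (auto intro: inv_rot_in_inv_seqs inj_on_subset[OF inj_inv_rot])
    have "inj_on (inv_rot k) {e \<in> inv_seqs n. M (Suc k) e = m}"
      by (rule inj_on_subset[OF inj_inv_rot]) simp
    then have "card {e \<in> inv_seqs n. M (Suc k) e = m} =
        card (inv_rot k ` {e \<in> inv_seqs n. M (Suc k) e = m})"
      by (rule card_image[symmetric])
    also have "inv_rot k ` {e \<in> inv_seqs n. M (Suc k) e = m} =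
        {e \<in> inv_rot k ` inv_seqs n. M k e = m}"
      unfolding step by blast
    finally show ?case
      unfolding onto using Suc by (rule trans)
  qed simp
  from this[of n] have "card {e \<in> inv_seqs n. M n e = m} = card {e \<in> inv_seqs n. M 0 e = m}" .
  moreover have "M n e = oc (Underline23 [1, 0, 1]) e" "M 0 e = oc (Underline23 [1, 1, 0]) e"
    if "e \<in> inv_seqs n" for e
  proof -
    have "\<forall>x \<in> set e. x < n"
      using that by (force simp: inv_seqs_def in_set_conv_nth)
    then show "M n e = oc (Underline23 [1, 0, 1]) e" "M 0 e = oc (Underline23 [1, 1, 0]) e"
      by (simp_all add: oc_eq_sum_tally M_def del: One_nat_def)
  qed
  ultimately show "card (inv_seqs_oc n (Underline23 [1, 0, 1]) m) =
      card (inv_seqs_oc n (Underline23 [1, 1, 0]) m)"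
    unfolding inv_seqs_oc_def by (simp cong: conj_cong)
qed

subsection \<open>Numerical values\<close>

text \<open>Recursion equations without binders: below a binder the simplifier would unfold
  \<^const>\<open>count_ext\<close> symbolically.\<close>

definition try_ext :: "vincular \<Rightarrow> nat \<Rightarrow> nat list \<Rightarrow> nat \<Rightarrow> nat \<Rightarrow> nat \<Rightarrow> nat" where
  "try_ext p k r m v d = (if d \<le> m then count_ext p k (v # r) (m - d) else 0)"

definition count_upto :: "vincular \<Rightarrow> nat \<Rightarrow> nat list \<Rightarrow> nat \<Rightarrow> nat \<Rightarrow> nat" where
  "count_upto p k r m u = (\<Sum>v\<le>u. try_ext p k r m v (new_occ p r v))"

definition count_matches :: "nat list \<Rightarrow> nat list \<Rightarrow> nat \<Rightarrow> nat \<Rightarrow> nat" where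
  "count_matches w r b c = length (filter (\<lambda>a. reduction [a, b, c] = w) r)"

lemma count_matches_simps:
  "count_matches w [] b c = 0"
  "count_matches w (a # r) b c =
     (if reduction [a, b, c] = w then Suc (count_matches w r b c) else count_matches w r b c)"
  by (simp_all add: count_matches_def)

lemma new_occ_simps:
  "new_occ (Underline12 w) [] c = 0"
  "new_occ (Underline12 w) [b] c = 0"
  "new_occ (Underline12 w) (b # a # r) c =
     (if reduction [a, b, c] = w then Suc (new_occ (Underline12 w) (a # r) c)
      else new_occ (Underline12 w) (a # r) c)"
  "new_occ (Underline23 w) [] c = 0"
  "new_occ (Underline23 w) (b # r) c = count_matches w r b c"
  by (simp_all add: count_matches_def)

lemma count_upto_simps:
  "count_upto p k r m 0 = try_ext p k r m 0 (new_occ p r 0)"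
  "count_upto p k r m (Suc u) =
     count_upto p k r m u + try_ext p k r m (Suc u) (new_occ p r (Suc u))"
  by (simp_all add: count_upto_def)

lemma try_ext_simps:
  "try_ext p k r m v 0 = count_ext p k (v # r) m"
  "try_ext p k r 0 v (Suc d) = 0"
  "try_ext p k r (Suc m) v (Suc d) = try_ext p k r m v d"
  by (simp_all add: try_ext_def)

lemma count_ext_simps:
  "count_ext p 0 r 0 = 1"
  "count_ext p 0 r (Suc m) = 0"
  "count_ext p (Suc k) r m = count_upto p k r m (length r)"
  by (simp_all add: count_upto_def try_ext_def)

lemmas count_eval = count_ext_simps count_upto_simps try_ext_simps new_occ_simps
  count_matches_simps reduction_eq_iff list.size(3,4) add_0_right add_Suc_right
  if_True if_False simp_thms nat.inject nat.distinct less_nat_zero_code Suc_less_eq zero_less_Suc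
  arith_simps rel_simps one_add_one numeral_plus_one one_plus_numeral

lemma count_ext_unary:
  "count_ext p 5 r m = count_ext p (Suc (Suc (Suc (Suc (Suc 0))))) r m"
  "count_ext p 6 r m = count_ext p (Suc (Suc (Suc (Suc (Suc (Suc 0)))))) r m"
  "count_ext p 7 r m = count_ext p (Suc (Suc (Suc (Suc (Suc (Suc (Suc 0))))))) r m"
  "count_ext p k r 1 = count_ext p k r (Suc 0)"
  by (simp_all add: eval_nat_numeral)

text \<open>The only repeated values are 217, 567, 584 and 680, for the four listed pairs, and 676,
  for 20-1 and 21-0.\<close>

lemma count_ext_6:
  "count_ext (Underline12 [0, 0, 0]) 6 [] 0 = 371"
  "count_ext (Underline12 [0, 0, 1]) 6 [] 0 = 178"
  "count_ext (Underline12 [0, 1, 0]) 6 [] 0 = 217"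
  "count_ext (Underline12 [1, 0, 0]) 6 [] 0 = 567"
  "count_ext (Underline12 [0, 1, 1]) 6 [] 0 = 217"
  "count_ext (Underline12 [1, 0, 1]) 6 [] 0 = 567"
  "count_ext (Underline12 [1, 1, 0]) 6 [] 0 = 586"
  "count_ext (Underline12 [0, 1, 2]) 6 [] 0 = 99"
  "count_ext (Underline12 [0, 2, 1]) 6 [] 0 = 530"
  "count_ext (Underline12 [1, 0, 2]) 6 [] 0 = 398"
  "count_ext (Underline12 [1, 2, 0]) 6 [] 0 = 549"
  "count_ext (Underline12 [2, 0, 1]) 6 [] 0 = 676"
  "count_ext (Underline12 [2, 1, 0]) 6 [] 0 = 676"
  "count_ext (Underline23 [0, 0, 0]) 6 [] 0 = 446"
  "count_ext (Underline23 [0, 0, 1]) 6 [] 0 = 32"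
  "count_ext (Underline23 [0, 1, 0]) 6 [] 0 = 216"
  "count_ext (Underline23 [1, 0, 0]) 6 [] 0 = 616"
  "count_ext (Underline23 [0, 1, 1]) 6 [] 0 = 382"
  "count_ext (Underline23 [1, 0, 1]) 6 [] 0 = 584"
  "count_ext (Underline23 [1, 1, 0]) 6 [] 0 = 584"
  "count_ext (Underline23 [0, 1, 2]) 6 [] 0 = 203"
  "count_ext (Underline23 [0, 2, 1]) 6 [] 0 = 426"
  "count_ext (Underline23 [1, 0, 2]) 6 [] 0 = 425"
  "count_ext (Underline23 [1, 2, 0]) 6 [] 0 = 532"
  "count_ext (Underline23 [2, 0, 1]) 6 [] 0 = 680"
  "count_ext (Underline23 [2, 1, 0]) 6 [] 0 = 680"
  by (simp_all only: count_eval count_ext_unary)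

lemma count_ext_7:
  "count_ext (Underline12 [2, 0, 1]) 7 [] 0 = 4356"
  "count_ext (Underline12 [2, 1, 0]) 7 [] 0 = 4362"
  by (simp_all only: count_eval count_ext_unary)

lemma count_ext_1:
  "count_ext (Underline12 [0, 1, 0]) 5 [] 1 = 52"
  "count_ext (Underline12 [0, 1, 1]) 5 [] 1 = 50"
  "count_ext (Underline12 [1, 0, 0]) 6 [] 1 = 134"
  "count_ext (Underline12 [1, 0, 1]) 6 [] 1 = 132"
  "count_ext (Underline23 [2, 0, 1]) 7 [] 1 = 466"
  "count_ext (Underline23 [2, 1, 0]) 7 [] 1 = 470"
  by (simp_all only: count_eval count_ext_unary)

subsection \<open>Classification\<close>

text \<open>The pattern 1-10 (10 underlined) cannot occur exactly at these positions: it would force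
  \<open>e\<^sub>2 = e\<^sub>4 > e\<^sub>5 = e\<^sub>3 > e\<^sub>6 \<ge> 0\<close> in 1-based notation, whereas \<open>e\<^sub>2 \<le> 1\<close>.\<close>

lemma not_super_strongly_wilf_equiv_101_110:
  "\<not> super_strongly_wilf_equiv (Underline23 [1, 0, 1]) (Underline23 [1, 1, 0])"
proof -
  let ?p = "Underline23 [1, 0, 1]" and ?q = "Underline23 [1, 1, 0]"
  \<comment> \<open>In \<open>?e\<close> the 0-based positions 1, 3, 4 carry 1, 0, 1 and the
    positions 2, 4, 5 carry 2, 1, 2.\<close>
  let ?S = "{{1, 3, 4}, {2, 4, 5 :: nat}}" and ?e = "[0, 1, 2, 0, 1, 2 :: nat]"
  have "inv_seqs_at 6 ?q ?S = {}"
  proof (rule equals0I)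
    fix e assume "e \<in> inv_seqs_at 6 ?q ?S"
    then have le: "e ! 1 \<le> 1" and S: "{1, 3, 4} \<in> occurrences ?q e" "{2, 4, 5} \<in> occurrences ?q e"
      by (auto simp: inv_seqs_at_def inv_seqs_def)
    have occ: "e ! y = e ! x \<and> e ! z < e ! y"
      if "{x, y, z} \<in> occurrences ?q e" "x < y" "y < z" for x y z
    proof -
      from that(1) obtain i1 i2 i3 where i: "{x, y, z} = {i1, i2, i3}" "i1 < i2" "i2 < i3"
        "reduction [e ! i1, e ! i2, e ! i3] = [1, 1, 0]"
        unfolding occurrences_def by auto
      have "x = i1 \<and> y = i2 \<and> z = i3"
        using i(1-3) that(2,3) by (smt (verit) insert_iff less_asym less_trans singletonD)
      then show ?thesis
        using i(4) by (simp add: reduction_eq_simps)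
    qed
    show False
      using occ[OF S(1)] occ[OF S(2)] le by simp
  qed
  moreover have "occurrences ?p ?e = ?S"
  proof (rule card_subset_eq[OF finite_occurrences, symmetric])
    have "{1, 3, 4} \<in> occurrences ?p ?e"
      unfolding occurrences_def mem_Collect_eq
      by (rule exI[of _ 1], rule exI[of _ 3], rule exI[of _ 4]) (simp add: reduction_eq_simps)
    moreover have "{2, 4, 5} \<in> occurrences ?p ?e"
      unfolding occurrences_def mem_Collect_eq
      by (rule exI[of _ 2], rule exI[of _ 4], rule exI[of _ 5]) (simp add: reduction_eq_simps)
    ultimately show "?S \<subseteq> occurrences ?p ?e" by simp
    have "oc ?p ?e = 2"
      using oc_Nil[of ?p] oc_snoc[of ?p "[]" 0] oc_snoc[of ?p "[0]" 1] oc_snoc[of ?p "[0, 1]" 2]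
        oc_snoc[of ?p "[0, 1, 2]" 0] oc_snoc[of ?p "[0, 1, 2, 0]" 1]
        oc_snoc[of ?p "[0, 1, 2, 0, 1]" 2]
      by (simp add: reduction_eq_simps)
    moreover have "{1, 3, 4} \<noteq> {2, 4, 5 :: nat}"
      by (intro notI, drule equalityD1) simp
    then have "card ?S = 2" by simp
    ultimately show "card ?S = card (occurrences ?p ?e)"
      by (simp add: oc_def)
  qed
  then have "?e \<in> inv_seqs_at 6 ?p ?S"
    by (simp add: inv_seqs_at_def inv_seqs_def eval_nat_numeral All_less_Suc)
  moreover have "finite (inv_seqs_at 6 ?p ?S)"
    unfolding inv_seqs_at_def by (rule finite_subset[OF _ finite_inv_seqs]) auto
  ultimately have "card (inv_seqs_at 6 ?p ?S) \<noteq> card (inv_seqs_at 6 ?q ?S)"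
    by (metis card_0_eq card.empty empty_iff)
  moreover have "?S \<subseteq> {A. A \<subseteq> {..<6} \<and> card A = 3}"
    by simp
  ultimately show ?thesis
    unfolding super_strongly_wilf_equiv_def by blast
qed

abbreviation listed_patterns :: "vincular set" where
  "listed_patterns \<equiv> \<Union>w \<in> {[0, 0, 0], [0, 0, 1], [0, 1, 0], [1, 0, 0], [0, 1, 1], [1, 0, 1],
     [1, 1, 0], [0, 1, 2], [0, 2, 1], [1, 0, 2], [1, 2, 0], [2, 0, 1], [2, 1, 0]}.
     {Underline12 w, Underline23 w}"

lemma hybrid_patterns_subset: "hybrid_patterns \<subseteq> listed_patterns" (is "_ \<subseteq> (\<Union>w \<in> ?L. _)")
proof
  fix p assume "p \<in> hybrid_patterns"
  then have p: "length (letters p) = 3" "set (letters p) \<subseteq> {0, 1, 2}"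
    "\<forall>j \<in> set (letters p). j > 0 \<longrightarrow> j - 1 \<in> set (letters p)"
    by (auto simp: hybrid_patterns_def)
  obtain a b c where abc: "letters p = [a, b, c]"
    using p(1) by (auto simp: length_Suc_conv numeral_3_eq_3)
  have "a = 0 \<or> a = 1 \<or> a = 2" "b = 0 \<or> b = 1 \<or> b = 2" "c = 0 \<or> c = 1 \<or> c = 2"
    using p(2) by (auto simp: abc)
  then have "letters p \<in> ?L"
    using p(3) unfolding abc by (elim disjE) simp_all
  moreover have "p \<in> {Underline12 (letters p), Underline23 (letters p)}"
    by (cases p) auto
  ultimately show "p \<in> (\<Union>w \<in> ?L. {Underline12 w, Underline23 w})"
    by blast
qed

text \<open>Avoidance is the case \<open>m = 0\<close> of strong and the case \<open>S = {}\<close>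
  of super-strong equivalence.\<close>

lemma generalized_wilf_equiv_imp_wilf_equiv:
  assumes "generalized_wilf_equiv p q"
  shows "wilf_equiv p q"
proof -
  have "inv_seqs_avoid n p' = inv_seqs_at n p' {}" for n p'
    by (simp add: inv_seqs_avoid_def inv_seqs_oc_def inv_seqs_at_def oc_def finite_occurrences)
  moreover have "wilf_equiv p q" if "strongly_wilf_equiv p q"
    using that by (simp add: strongly_wilf_equiv_def wilf_equiv_def inv_seqs_avoid_def)
  ultimately show ?thesis
    using assms unfolding generalized_wilf_equiv_def super_strongly_wilf_equiv_def wilf_equiv_def
    by (metis empty_subsetI)
qed

lemma wilf_equivE:
  assumes "wilf_equiv p q"
  shows "count_ext p n [] 0 = count_ext q n [] 0"
  using assms by (simp add: wilf_equiv_iff)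

lemma not_strongly_wilf_equivI:
  "count_ext p n [] m \<noteq> count_ext q n [] m \<Longrightarrow> \<not> strongly_wilf_equiv p q"
  by (auto simp: strongly_wilf_equiv_def card_inv_seqs_oc)

theorem theorem2p1:
  "wilf_equiv (Underline12 [0, 1, 0]) (Underline12 [0, 1, 1]) \<and>
   \<not> strongly_wilf_equiv (Underline12 [0, 1, 0]) (Underline12 [0, 1, 1]) \<and>
   wilf_equiv (Underline12 [1, 0, 0]) (Underline12 [1, 0, 1]) \<and>
   \<not> strongly_wilf_equiv (Underline12 [1, 0, 0]) (Underline12 [1, 0, 1]) \<and>
   strongly_wilf_equiv (Underline23 [1, 0, 1]) (Underline23 [1, 1, 0]) \<and>
   \<not> super_strongly_wilf_equiv (Underline23 [1, 0, 1]) (Underline23 [1, 1, 0]) \<and>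
   wilf_equiv (Underline23 [2, 0, 1]) (Underline23 [2, 1, 0]) \<and>
   \<not> strongly_wilf_equiv (Underline23 [2, 0, 1]) (Underline23 [2, 1, 0]) \<and>
   (\<forall>p \<in> hybrid_patterns. \<forall>q \<in> hybrid_patterns. p \<noteq> q \<and> generalized_wilf_equiv p q \<longrightarrow>
      {p, q} \<in> {{Underline12 [0, 1, 0], Underline12 [0, 1, 1]},
                 {Underline12 [1, 0, 0], Underline12 [1, 0, 1]},
                 {Underline23 [1, 0, 1], Underline23 [1, 1, 0]},
                 {Underline23 [2, 0, 1], Underline23 [2, 1, 0]}})"
proof (intro conjI ballI impI)
  show "\<not> strongly_wilf_equiv (Underline12 [0, 1, 0]) (Underline12 [0, 1, 1])"
    by (rule not_strongly_wilf_equivI[where n = 5 and m = 1]) (simp add: count_ext_1 del: One_nat_def)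
  show "\<not> strongly_wilf_equiv (Underline12 [1, 0, 0]) (Underline12 [1, 0, 1])"
    by (rule not_strongly_wilf_equivI[where n = 6 and m = 1]) (simp add: count_ext_1 del: One_nat_def)
  show "\<not> strongly_wilf_equiv (Underline23 [2, 0, 1]) (Underline23 [2, 1, 0])"
    by (rule not_strongly_wilf_equivI[where n = 7 and m = 1]) (simp add: count_ext_1 del: One_nat_def)
next
  fix p q assume p: "p \<in> hybrid_patterns" and q: "q \<in> hybrid_patterns"
    and "p \<noteq> q \<and> generalized_wilf_equiv p q"
  then have neq: "p \<noteq> q" and "wilf_equiv p q"
    using generalized_wilf_equiv_imp_wilf_equiv by auto
  then have eq: "count_ext p 6 [] 0 = count_ext q 6 [] 0" "count_ext p 7 [] 0 = count_ext q 7 [] 0"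
    by (simp_all only: wilf_equivE)
  let ?goal = "\<lambda>p q. {p, q} \<in> {{Underline12 [0, 1, 0], Underline12 [0, 1, 1]},
                 {Underline12 [1, 0, 0], Underline12 [1, 0, 1]},
                 {Underline23 [1, 0, 1], Underline23 [1, 1, 0]},
                 {Underline23 [2, 0, 1], Underline23 [2, 1, 0]}}"
  \<comment> \<open>Length 6 leaves one pair too many, which length 7 then excludes.\<close>
  have sep: "\<forall>p \<in> listed_patterns. \<forall>q \<in> listed_patterns.
    count_ext p 6 [] 0 = count_ext q 6 [] 0 \<longrightarrow> p \<noteq> q \<longrightarrow> ?goal p q \<or> {p, q} = {Underline12 [2, 0, 1], Underline12 [2, 1, 0]}"
    by (simp add: count_ext_6 doubleton_eq_iff del: One_nat_def)
  have cases: "?goal p q \<or> {p, q} = {Underline12 [2, 0, 1], Underline12 [2, 1, 0]}"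
    by (rule sep[THEN bspec, THEN bspec, THEN mp, THEN mp,
          OF subsetD[OF hybrid_patterns_subset p] subsetD[OF hybrid_patterns_subset q] eq(1) neq])
  have neq': "{p, q} \<noteq> {Underline12 [2, 0, 1], Underline12 [2, 1, 0]}"
    using eq(2) count_ext_7 by (auto simp: doubleton_eq_iff simp del: One_nat_def)
  from cases show "?goal p q"
  proof
    assume "{p, q} = {Underline12 [2, 0, 1], Underline12 [2, 1, 0]}"
    with neq' show ?thesis by contradiction
  qed
qed (fact wilf_equiv_010_011 wilf_equiv_100_101 strongly_wilf_equiv_101_110
    not_super_strongly_wilf_equiv_101_110 wilf_equiv_201_210)+

end
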